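(* For every prime number $p$ and every integer $n>1$, there exists a simple solution $(X,r)$ of the Yang--Baxter equation (involutive, non-degenerate, set-theoretic) of cardinality $|X|=p^n$.
   Context: A solution of the YBE means an involutive, non-degenerate, set-theoretic solution of the Yang--Baxter equation: a pair $(X,r)$ where $X$ is a non-empty set and $r\colon X\times X\to X\times X$ is a map, written $r(x,y)=(\sigma_x(y),\gamma_y(x))$, such that $r^2=\mathrm{id}$, all maps $\sigma_x,\gamma_y\colon X\to X$ are bijective, and $r_{12}r_{23}r_{12}=r_{23}r_{12}r_{23}$ on $X^3$, where $r_{12}=r\times \mathrm{id}_X$ and $r_{23}=\mathrm{id}_X\times r$. A homomorphism of solutions $f\colon (X,r)\to (Y,s)$, with $r(x,y)=(\sigma_x(y),\gamma_y(x))$ and $s(t,z)=(\sigma'_t(z),\gamma'_z(t))$, is a map $f\colon X\to Y$ such that $f(\sigma_x(y))=\sigma'_{f(x)}(f(y))$ and $f(\gamma_y(x))=\gamma'_{f(y)}(f(x))$ for all $x,y\in X$. An epimorphism is a surjective homomorphism; an isomorphism is a bijective homomorphism. A solution $(X,r)$ of the YBE is simple if $|X|>1$ and for every epimorphism of solutions $f\colon (X,r)\to (Y,s)$ either $f$ is an isomorphism or $|Y|=1$. *)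

theory Defs
  imports "HOL-Computational_Algebra.Primes" "HOL-Library.FuncSet"
begin

text \<open>
  Set-theoretic solutions live on a carrier set; the map \<open>r\<close> is total in HOL, and only its
  values on \<open>X \<times> X\<close> matter.  We write \<open>r (x, y) = (ybe_sigma r x y, ybe_gamma r y x)\<close>.
\<close>

definition ybe_sigma :: "('a \<times> 'a \<Rightarrow> 'a \<times> 'a) \<Rightarrow> 'a \<Rightarrow> 'a \<Rightarrow> 'a" where
  "ybe_sigma r x y = fst (r (x, y))"

definition ybe_gamma :: "('a \<times> 'a \<Rightarrow> 'a \<times> 'a) \<Rightarrow> 'a \<Rightarrow> 'a \<Rightarrow> 'a" where
  "ybe_gamma r y x = snd (r (x, y))"

definition ybe_12 :: "('a \<times> 'a \<Rightarrow> 'a \<times> 'a) \<Rightarrow> 'a \<times> 'a \<times> 'a \<Rightarrow> 'a \<times> 'a \<times> 'a" where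
  "ybe_12 r = (\<lambda>(x, y, z). (fst (r (x, y)), snd (r (x, y)), z))"

definition ybe_23 :: "('a \<times> 'a \<Rightarrow> 'a \<times> 'a) \<Rightarrow> 'a \<times> 'a \<times> 'a \<Rightarrow> 'a \<times> 'a \<times> 'a" where
  "ybe_23 r = (\<lambda>(x, y, z). (x, r (y, z)))"

definition ybe_solution :: "'a set \<Rightarrow> ('a \<times> 'a \<Rightarrow> 'a \<times> 'a) \<Rightarrow> bool" where
  "ybe_solution X r \<longleftrightarrow>
     X \<noteq> {} \<and>
     r \<in> X \<times> X \<rightarrow> X \<times> X \<and>
     (\<forall>u \<in> X \<times> X. r (r u) = u) \<and>
     (\<forall>x \<in> X. bij_betw (ybe_sigma r x) X X) \<and>
     (\<forall>y \<in> X. bij_betw (ybe_gamma r y) X X) \<and>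
     (\<forall>t \<in> X \<times> X \<times> X.
        ybe_12 r (ybe_23 r (ybe_12 r t)) = ybe_23 r (ybe_12 r (ybe_23 r t)))"

definition ybe_hom ::
  "'a set \<Rightarrow> ('a \<times> 'a \<Rightarrow> 'a \<times> 'a) \<Rightarrow> 'b set \<Rightarrow> ('b \<times> 'b \<Rightarrow> 'b \<times> 'b) \<Rightarrow> ('a \<Rightarrow> 'b) \<Rightarrow> bool" where
  "ybe_hom X r Y s f \<longleftrightarrow>
     f \<in> X \<rightarrow> Y \<and>
     (\<forall>x \<in> X. \<forall>y \<in> X.
        f (ybe_sigma r x y) = ybe_sigma s (f x) (f y) \<and>
        f (ybe_gamma r y x) = ybe_gamma s (f y) (f x))"

definition ybe_epi ::
  "'a set \<Rightarrow> ('a \<times> 'a \<Rightarrow> 'a \<times> 'a) \<Rightarrow> 'b set \<Rightarrow> ('b \<times> 'b \<Rightarrow> 'b \<times> 'b) \<Rightarrow> ('a \<Rightarrow> 'b) \<Rightarrow> bool" where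
  "ybe_epi X r Y s f \<longleftrightarrow> ybe_hom X r Y s f \<and> f ` X = Y"

definition ybe_iso ::
  "'a set \<Rightarrow> ('a \<times> 'a \<Rightarrow> 'a \<times> 'a) \<Rightarrow> 'b set \<Rightarrow> ('b \<times> 'b \<Rightarrow> 'b \<times> 'b) \<Rightarrow> ('a \<Rightarrow> 'b) \<Rightarrow> bool" where
  "ybe_iso X r Y s f \<longleftrightarrow> ybe_hom X r Y s f \<and> bij_betw f X Y"

text \<open>
  HOL cannot quantify over the type of \<open>Y\<close> inside a formula, so the targets \<open>Y\<close> range over
  subsets of the type carrying \<open>X\<close>.  This loses nothing, since every epimorphic image of \<open>X\<close> has
  a copy inside \<open>X\<close>: see \<open>ybe_simple_epi\<close> below, where \<open>Y\<close> lives on an arbitrary type.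
  The disjunct \<open>infinite X\<close> is there because \<open>card\<close> is \<open>0\<close> on infinite sets.
\<close>

definition ybe_simple :: "'a set \<Rightarrow> ('a \<times> 'a \<Rightarrow> 'a \<times> 'a) \<Rightarrow> bool" where
  "ybe_simple X r \<longleftrightarrow>
     ybe_solution X r \<and>
     (infinite X \<or> card X > 1) \<and>
     (\<forall>(Y :: 'a set) s f.
        ybe_solution Y s \<and> ybe_epi X r Y s f \<longrightarrow> ybe_iso X r Y s f \<or> card Y = 1)"

lemma ybe_solution_transport:
  assumes sol: "ybe_solution Y s" and g: "bij_betw g Y Z" and h: "\<And>y. y \<in> Y \<Longrightarrow> h (g y) = y"
  shows "ybe_solution Z (\<lambda>u. map_prod g g (s (map_prod h h u)))" (is "ybe_solution Z ?t")
proof -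
  have Z: "Z = g ` Y" using g by (simp add: bij_betw_def)
  have sY: "fst (s (x, y)) \<in> Y \<and> snd (s (x, y)) \<in> Y" if "x \<in> Y" "y \<in> Y" for x y
    using sol that unfolding ybe_solution_def by (auto simp: Pi_iff mem_Times_iff)
  have t: "?t (g x, g y) = (g (fst (s (x, y))), g (snd (s (x, y))))" if "x \<in> Y" "y \<in> Y" for x y
    using that by (simp add: h map_prod_def case_prod_beta)
  have hb: "bij_betw h Z Y"
    by (rule bij_betw_byWitness[where f' = g]) (auto simp: Z h)
  have bij: "bij_betw k' Z Z"
    if k: "bij_betw k Y Y" and k': "\<And>y. y \<in> Y \<Longrightarrow> k' (g y) = g (k y)" for k k'
  proof -
    have "bij_betw (g \<circ> k \<circ> h) Z Z"
      using bij_betw_trans[OF bij_betw_trans[OF hb k] g] by (simp add: comp_assoc)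
    moreover have "\<And>z. z \<in> Z \<Longrightarrow> k' z = (g \<circ> k \<circ> h) z"
      by (auto simp: Z h k')
    ultimately show ?thesis by (simp cong: bij_betw_cong)
  qed
  have inv: "s (s (x, y)) = (x, y)" if "x \<in> Y" "y \<in> Y" for x y
    using sol that unfolding ybe_solution_def by auto
  have "?t (?t (g x, g y)) = (g x, g y)" if "x \<in> Y" "y \<in> Y" for x y
    using that inv[OF that] sY[OF that] by (simp only: t prod.collapse) simp
  moreover have "bij_betw (ybe_sigma ?t (g x)) Z Z" if "x \<in> Y" for x
    by (rule bij[of "ybe_sigma s x"])
       (use sol that t in \<open>auto simp: ybe_solution_def ybe_sigma_def\<close>)
  moreover have "bij_betw (ybe_gamma ?t (g x)) Z Z" if "x \<in> Y" for x
    by (rule bij[of "ybe_gamma s x"])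
       (use sol that t in \<open>auto simp: ybe_solution_def ybe_gamma_def\<close>)
  moreover have "ybe_12 ?t (ybe_23 ?t (ybe_12 ?t (g x, g y, g z))) =
      ybe_23 ?t (ybe_12 ?t (ybe_23 ?t (g x, g y, g z)))"
    if "x \<in> Y" "y \<in> Y" "z \<in> Y" for x y z
  proof -
    define G where "G = (\<lambda>(x, y, z). (g x, g y, g z))"
    have c12: "ybe_12 ?t (G u) = G (ybe_12 s u)" if "u \<in> Y \<times> Y \<times> Y" for u
      using that by (auto simp: G_def ybe_12_def h)
    have c23: "ybe_23 ?t (G u) = G (ybe_23 s u)" if "u \<in> Y \<times> Y \<times> Y" for u
      using that by (auto simp: G_def ybe_23_def h map_prod_def case_prod_beta)
    have m12: "ybe_12 s u \<in> Y \<times> Y \<times> Y" if "u \<in> Y \<times> Y \<times> Y" for u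
      using that sY by (auto simp: ybe_12_def)
    have m23: "ybe_23 s u \<in> Y \<times> Y \<times> Y" if "u \<in> Y \<times> Y \<times> Y" for u
      using that sY[of "fst (snd u)" "snd (snd u)"]
      by (simp add: ybe_23_def mem_Times_iff case_prod_beta)
    have u: "(x, y, z) \<in> Y \<times> Y \<times> Y" using that by simp
    have "ybe_12 s (ybe_23 s (ybe_12 s (x, y, z))) = ybe_23 s (ybe_12 s (ybe_23 s (x, y, z)))"
      using sol u unfolding ybe_solution_def by blast
    then have "ybe_12 ?t (ybe_23 ?t (ybe_12 ?t (G (x, y, z)))) =
        ybe_23 ?t (ybe_12 ?t (ybe_23 ?t (G (x, y, z))))"
      using u by (simp only: c12 c23 m12 m23)
    then show ?thesis by (simp add: G_def)
  qed
  moreover have "?t \<in> Z \<times> Z \<rightarrow> Z \<times> Z"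
    using t sY by (fastforce simp: Z)
  moreover have "Z \<noteq> {}" using sol by (simp add: Z ybe_solution_def)
  ultimately show ?thesis
    unfolding ybe_solution_def by (auto simp: Z)
qed

lemma ybe_simple_epi:
  fixes X :: "'a set" and Y :: "'b set"
  assumes simple: "ybe_simple X r" and sol: "ybe_solution Y s" and epi: "ybe_epi X r Y s f"
  shows "ybe_iso X r Y s f \<or> card Y = 1"
proof -
  define g where "g = inv_into X f"
  define t where "t = (\<lambda>u. map_prod g g (s (map_prod f f u)))"
  have fX: "f ` X = Y" and hom: "ybe_hom X r Y s f" using epi by (auto simp: ybe_epi_def)
  have fg: "f (g y) = y" and gX: "g y \<in> X" if "y \<in> Y" for y
    using that fX by (auto simp: g_def f_inv_into_f inv_into_into)
  have g: "bij_betw g Y (g ` Y)"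
    by (rule bij_betw_byWitness[where f' = f]) (auto simp: fg)
  have solt: "ybe_solution (g ` Y) t"
    unfolding t_def by (rule ybe_solution_transport[OF sol g fg])
  have fY: "f x \<in> Y" if "x \<in> X" for x using that fX by auto
  have "ybe_epi X r (g ` Y) t (g \<circ> f)"
    using hom fX fY unfolding ybe_epi_def ybe_hom_def
    by (auto simp: t_def ybe_sigma_def ybe_gamma_def fg image_comp[symmetric])
  then have "ybe_iso X r (g ` Y) t (g \<circ> f) \<or> card (g ` Y) = 1"
    using simple solt unfolding ybe_simple_def by blast
  moreover have "card (g ` Y) = card Y" using g by (metis bij_betw_same_card)
  moreover have "ybe_iso X r Y s f" if "ybe_iso X r (g ` Y) t (g \<circ> f)"
  proof -
    have "inj_on f X"
      using that by (auto simp: ybe_iso_def bij_betw_def dest: inj_on_imageI2)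
    then show ?thesis using hom fX by (simp add: ybe_iso_def bij_betw_def)
  qed
  ultimately show ?thesis by auto
qed

end

theory Submission imports Defs "HOL-Number_Theory.Cong"
begin

text \<open>
  A cycle set \<open>(X, \<cdot>)\<close> in the sense of Rump gives the solution \<open>r (x, x \<cdot> u) = (u, u \<cdot> x)\<close>.
  Take \<open>X = (\<int>/p)\<^sup>n\<close> and let \<open>x \<cdot> y\<close> be \<open>y\<close> with its first coordinate raised by the last
  coordinate of \<open>x\<close>, and any later coordinate \<open>i\<close> raised by \<open>1\<close> exactly if \<open>x\<close> and \<open>y\<close> agree
  on all coordinates before \<open>i\<close>.

  Given a congruence identifying two distinct points, the pair can be moved until it differs in the
  last coordinate only. Such a pair acts differently on the first coordinate only, so the first
  coordinate becomes irrelevant (here \<open>p\<close> is prime). Two points that differ in the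
  first coordinate only act differently on the remaining coordinates, which then
  become irrelevant one after the other.
\<close>

section \<open>Solutions from cycle sets\<close>

text \<open>Non-degeneracy is kept separate: it enters \<open>ybe_solution_cycle_map\<close> as the
  hypothesis \<open>inj\<close>.\<close>

definition cycle_set :: "'a set \<Rightarrow> ('a \<Rightarrow> 'a \<Rightarrow> 'a) \<Rightarrow> bool" where
  "cycle_set X m \<longleftrightarrow>
     (\<forall>x \<in> X. bij_betw (m x) X X) \<and>
     (\<forall>x \<in> X. \<forall>y \<in> X. \<forall>z \<in> X. m (m x y) (m x z) = m (m y x) (m y z))"

definition cycle_map :: "'a set \<Rightarrow> ('a \<Rightarrow> 'a \<Rightarrow> 'a) \<Rightarrow> 'a \<times> 'a \<Rightarrow> 'a \<times> 'a" where
  "cycle_map X m = (\<lambda>(x, y). let u = inv_into X (m x) y in (u, m u x))"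

lemma cycle_set_closed: "cycle_set X m \<Longrightarrow> x \<in> X \<Longrightarrow> y \<in> X \<Longrightarrow> m x y \<in> X"
  unfolding cycle_set_def by (blast dest: bij_betwE)

lemma cycle_set_surj:
  assumes "cycle_set X m" "x \<in> X" "y \<in> X"
  obtains u where "u \<in> X" "y = m x u"
  using assms unfolding cycle_set_def bij_betw_def by blast

lemma cycle_map_apply:
  assumes "cycle_set X m" "x \<in> X" "u \<in> X"
  shows "cycle_map X m (x, m x u) = (u, m u x)"
  using assms by (simp add: cycle_map_def cycle_set_def bij_betw_def inv_into_f_f)

text \<open>The gamma map of \<open>y\<close> sends \<open>x\<close> to \<open>m u x\<close>, where
  \<open>y = m x u\<close>. Hence \<open>inj\<close> makes every gamma map injective, and finiteness
  makes it bijective.\<close>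

lemma ybe_solution_cycle_map:
  assumes cs: "cycle_set X m" and fin: "finite X" and ne: "X \<noteq> {}"
    and inj: "\<And>x u x' u'. \<lbrakk>x \<in> X; u \<in> X; x' \<in> X; u' \<in> X; m x u = m x' u'; m u x = m u' x'\<rbrakk> \<Longrightarrow> x = x'"
  shows "ybe_solution X (cycle_map X m)" (is "ybe_solution X ?r")
proof -
  note cl = cycle_set_closed[OF cs] and ap = cycle_map_apply[OF cs]
  have bij: "bij_betw (m x) X X" if "x \<in> X" for x
    using cs that unfolding cycle_set_def by blast
  have braid: "m (m x y) (m x z) = m (m y x) (m y z)" if "x \<in> X" "y \<in> X" "z \<in> X" for x y z
    using cs that unfolding cycle_set_def by blast
  have closed: "?r u \<in> X \<times> X" and invol: "?r (?r u) = u" if u: "u \<in> X \<times> X" for u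
  proof -
    obtain x y where xy: "u = (x, y)" "x \<in> X" "y \<in> X" using u by blast
    obtain v where "v \<in> X" "y = m x v" using cycle_set_surj[OF cs xy(2,3)] .
    with xy show "?r u \<in> X \<times> X" "?r (?r u) = u" by (simp_all add: ap cl)
  qed
  have sigma: "bij_betw (ybe_sigma ?r x) X X" if "x \<in> X" for x
    using bij_betw_inv_into[OF bij[OF that]]
    by (simp add: ybe_sigma_def[abs_def] cycle_map_def Let_def)
  have gamma: "bij_betw (ybe_gamma ?r y) X X" if y: "y \<in> X" for y
  proof -
    have "ybe_gamma ?r y ` X \<subseteq> X"
      using closed y by (auto simp: ybe_gamma_def mem_Times_iff)
    moreover have "inj_on (ybe_gamma ?r y) X"
    proof (rule inj_onI)
      fix x x' assume x: "x \<in> X" "x' \<in> X" and eq: "ybe_gamma ?r y x = ybe_gamma ?r y x'"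
      obtain u where u: "u \<in> X" "y = m x u" using cycle_set_surj[OF cs x(1) y] .
      obtain u' where u': "u' \<in> X" "y = m x' u'" using cycle_set_surj[OF cs x(2) y] .
      have "m u x = m u' x'"
        using eq ap[OF x(1) u(1)] ap[OF x(2) u'(1)] u(2) u'(2) by (simp add: ybe_gamma_def)
      then show "x = x'" using inj x u u' by metis
    qed
    ultimately show ?thesis using fin by (simp add: bij_betw_def endo_inj_surj)
  qed
  have ybe: "ybe_12 ?r (ybe_23 ?r (ybe_12 ?r t)) = ybe_23 ?r (ybe_12 ?r (ybe_23 ?r t))"
    if t: "t \<in> X \<times> X \<times> X" for t
  proof -
    \<comment> \<open>In the coordinates \<open>a, b, c\<close> the two maps \<open>r\<^sub>1\<^sub>2\<close>, \<open>r\<^sub>2\<^sub>3\<close> are the transpositions.\<close>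
    define P where "P a b c = (a, m a b, m (m a b) (m a c))" for a b c
    have P12: "ybe_12 ?r (P a b c) = P b a c" if "a \<in> X" "b \<in> X" "c \<in> X" for a b c
      by (simp only: P_def ybe_12_def prod.case ap[OF that(1,2)] fst_conv snd_conv braid[OF that])
    have P23: "ybe_23 ?r (P a b c) = P a c b" if "a \<in> X" "b \<in> X" "c \<in> X" for a b c
      by (simp only: P_def ybe_23_def prod.case ap[OF cl[OF that(1,2)] cl[OF that(1,3)]])
    obtain a y z where a: "t = (a, y, z)" "a \<in> X" "y \<in> X" "z \<in> X" using t by blast
    \<comment> \<open>Surjectivity of each \<open>m x\<close> puts every triple into the form
      \<open>P a b c\<close>. Both sides of the braid equation then come out as
      \<open>P c b a\<close>.\<close>
    obtain b where b: "b \<in> X" "y = m a b" using cycle_set_surj[OF cs a(2,3)] .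
    obtain c' where c': "c' \<in> X" "z = m y c'" using cycle_set_surj[OF cs a(3,4)] .
    obtain c where c: "c \<in> X" "c' = m a c" using cycle_set_surj[OF cs a(2) c'(1)] .
    have "t = P a b c" by (simp only: P_def a(1) b(2) c'(2) c(2))
    then show ?thesis by (simp only: P12 P23 a(2) b(1) c(1))
  qed
  show ?thesis
    unfolding ybe_solution_def
    by (intro conjI ballI Pi_I ne closed invol sigma gamma ybe)
qed

text \<open>A congruence is represented as the kernel of a function \<open>f\<close>.\<close>

lemma ybe_simple_cycle_map:
  fixes X :: "'a set"
  assumes cs: "cycle_set X m" and sol: "ybe_solution X (cycle_map X m)" and card: "card X > 1"
    and cong: "\<And>f :: 'a \<Rightarrow> 'a.
       \<lbrakk>\<And>x x' y y'. \<lbrakk>x \<in> X; x' \<in> X; y \<in> X; y' \<in> X; f x = f x'; f y = f y'\<rbrakk>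
          \<Longrightarrow> f (m x y) = f (m x' y');
        \<not> inj_on f X\<rbrakk> \<Longrightarrow> \<exists>c. \<forall>x \<in> X. f x = c"
  shows "ybe_simple X (cycle_map X m)"
  unfolding ybe_simple_def
proof (intro conjI allI impI sol)
  show "infinite X \<or> card X > 1" using card by simp
next
  fix Y s and f :: "'a \<Rightarrow> 'a"
  assume "ybe_solution Y s \<and> ybe_epi X (cycle_map X m) Y s f"
  then have Y: "ybe_solution Y s" and hom: "ybe_hom X (cycle_map X m) Y s f" and im: "f ` X = Y"
    by (auto simp: ybe_epi_def)
  note cl = cycle_set_closed[OF cs]
  have f_sigma: "f y = ybe_sigma s (f x) (f (m x y))" if "x \<in> X" "y \<in> X" for x y
  proof -
    have "f (ybe_sigma (cycle_map X m) x (m x y)) = ybe_sigma s (f x) (f (m x y))"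
      using hom that cl unfolding ybe_hom_def by blast
    then show ?thesis by (simp add: ybe_sigma_def cycle_map_apply[OF cs that])
  qed
  \<comment> \<open>By \<open>f_sigma\<close>, the bijection \<open>ybe_sigma s (f x)\<close> takes
    both values to \<open>f y = f y'\<close>; cancelling it shows that the kernel of
    \<open>f\<close> respects \<open>m\<close> itself.\<close>
  have f_cong: "f (m x y) = f (m x' y')"
    if "x \<in> X" "x' \<in> X" "y \<in> X" "y' \<in> X" "f x = f x'" "f y = f y'" for x x' y y'
  proof (rule inj_onD[of "ybe_sigma s (f x)" Y])
    show "inj_on (ybe_sigma s (f x)) Y"
      using Y im that(1) unfolding ybe_solution_def by (blast intro: bij_betw_imp_inj_on)
    show "ybe_sigma s (f x) (f (m x y)) = ybe_sigma s (f x) (f (m x' y'))"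
      using f_sigma that by metis
  qed (use im cl that in auto)
  show "ybe_iso X (cycle_map X m) Y s f \<or> card Y = 1"
  proof (cases "inj_on f X")
    case True
    then show ?thesis using hom im by (simp add: ybe_iso_def bij_betw_def)
  next
    case False
    then obtain c where "\<forall>x \<in> X. f x = c" using cong[of f] f_cong by blast
    moreover have "X \<noteq> {}" using card by auto
    ultimately have "Y = {c}" using im by auto
    then show ?thesis by simp
  qed
qed

text \<open>This moves the example from functions to natural numbers. An epimorphism out of
  \<open>Z\<close> composed with \<open>g\<close> is one out of \<open>X\<close>, and
  \<open>ybe_simple_epi\<close> applies to it even though its target lives on another type.\<close>

lemma ybe_simple_transport:
  fixes X :: "'a set" and Z :: "'b set"
  assumes simple: "ybe_simple X r" and g: "bij_betw g X Z"
  shows "\<exists>t. ybe_simple Z t"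
proof -
  define h where "h = inv_into X g"
  define t where "t = (\<lambda>u. map_prod g g (r (map_prod h h u)))"
  have hg: "h (g x) = x" if "x \<in> X" for x
    using g that by (simp add: h_def bij_betw_def)
  have Z: "g ` X = Z" using g by (simp add: bij_betw_def)
  have solX: "ybe_solution X r" using simple by (simp add: ybe_simple_def)
  have sol: "ybe_solution Z t"
    unfolding t_def by (rule ybe_solution_transport[OF solX g hg])
  have homg: "ybe_hom X r Z t g"
    using Z by (auto simp: ybe_hom_def t_def ybe_sigma_def ybe_gamma_def hg)
  have card: "infinite Z \<or> card Z > 1"
    using simple bij_betw_finite[OF g] bij_betw_same_card[OF g] by (simp add: ybe_simple_def)
  have "ybe_iso Z t Y s f \<or> card Y = 1"
    if "ybe_solution Y s" "ybe_epi Z t Y s f" for Y :: "'b set" and s f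
  proof -
    have hom: "ybe_hom Z t Y s f" using that(2) by (simp add: ybe_epi_def)
    have "ybe_hom X r Y s (f \<circ> g)"
      using hom homg by (auto simp: ybe_hom_def Pi_iff)
    moreover have "(f \<circ> g) ` X = Y"
      using that(2) Z by (auto simp: ybe_epi_def)
    ultimately have "ybe_epi X r Y s (f \<circ> g)" by (simp add: ybe_epi_def)
    then have "ybe_iso X r Y s (f \<circ> g) \<or> card Y = 1"
      using ybe_simple_epi[OF simple that(1)] by blast
    then show ?thesis
      using hom bij_betw_comp_iff[OF g, of f Y] by (auto simp: ybe_iso_def)
  qed
  then show ?thesis using sol card unfolding ybe_simple_def by blast
qed

section \<open>The twisted odometer\<close>

text \<open>Coordinates run over \<open>{..N}\<close>, so \<open>N\<close> is \<open>n - 1\<close>.\<close>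

definition digits :: "nat \<Rightarrow> nat \<Rightarrow> (nat \<Rightarrow> int) set" where
  "digits p N = {..N} \<rightarrow>\<^sub>E {0..<int p}"

text \<open>At \<open>i = 0\<close> the agreement condition is vacuous and would always add 1;
  adding \<open>x N\<close> instead is the twist that ties the first coordinate to the last. The
  restriction to \<open>{..N}\<close> gives the extensional functions that \<open>digits\<close>
  consists of.\<close>

definition odo :: "nat \<Rightarrow> nat \<Rightarrow> (nat \<Rightarrow> int) \<Rightarrow> (nat \<Rightarrow> int) \<Rightarrow> nat \<Rightarrow> int" where
  "odo p N x y = (\<lambda>i\<in>{..N}.
     (y i + (if i = 0 then x N else of_bool (\<forall>k<i. x k = y k))) mod int p)"

lemma digits_bounds: "x \<in> digits p N \<Longrightarrow> i \<le> N \<Longrightarrow> 0 \<le> x i \<and> x i < int p"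
  unfolding digits_def by (auto simp: PiE_iff)

lemma digits_mod: "x \<in> digits p N \<Longrightarrow> i \<le> N \<Longrightarrow> x i mod int p = x i"
  using digits_bounds by (simp add: mod_pos_pos_trivial)

lemma digits_ext:
  "x \<in> digits p N \<Longrightarrow> y \<in> digits p N \<Longrightarrow> (\<And>i. i \<le> N \<Longrightarrow> x i = y i) \<Longrightarrow> x = y"
  unfolding digits_def by (auto intro: PiE_ext)

lemma finite_digits: "finite (digits p N)"
  unfolding digits_def by (intro finite_PiE) auto

lemma card_digits: "card (digits p N) = p ^ Suc N"
  unfolding digits_def by (simp add: card_PiE)

lemma digits_upd:
  "x \<in> digits p N \<Longrightarrow> i \<le> N \<Longrightarrow> 0 \<le> v \<Longrightarrow> v < int p \<Longrightarrow> x(i := v) \<in> digits p N"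
  unfolding digits_def by (auto simp: PiE_iff extensional_def)

lemma mod_add_cancel_bounded:
  fixes a b c q :: int
  assumes "(a + c) mod q = (b + c) mod q" "0 \<le> a" "a < q" "0 \<le> b" "b < q"
  shows "a = b"
proof -
  have "[a = b] (mod q)" using assms(1) by (simp add: cong_def[symmetric] cong_add_rcancel)
  then show ?thesis using assms(2-) by (simp add: cong_def)
qed

lemma digits_add_cancel:
  assumes "(x i + c) mod int p = (y i + c) mod int p" "x \<in> digits p N" "y \<in> digits p N" "i \<le> N"
  shows "x i = y i"
  using mod_add_cancel_bounded[OF assms(1)] digits_bounds assms(2-4) by blast

section \<open>Left multiplications of the odometer and common prefixes\<close>

lemma odo_digits: "p > 0 \<Longrightarrow> odo p N x y \<in> digits p N"
  unfolding odo_def digits_def by auto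

lemma odo_unchanged:
  assumes "y \<in> digits p N" "l < i" "i \<le> N" "x l \<noteq> y l"
  shows "odo p N x y i = y i"
proof -
  have "(\<forall>k<i. x k = y k) \<longleftrightarrow> False" using assms by blast
  moreover have "odo p N x y i = (y i + of_bool (\<forall>k<i. x k = y k)) mod int p"
    using assms by (simp add: odo_def)
  ultimately show ?thesis using digits_mod[OF assms(1,3)] by (simp only: of_bool_eq) simp
qed

text \<open>Induction on \<open>i\<close>: as long as \<open>y\<close> and \<open>z\<close> agree
  before \<open>i\<close>, the same amount \<open>c\<close> is added to both at \<open>i\<close>,
  and it cancels modulo \<open>p\<close>.\<close>

lemma odo_agree:
  assumes "y \<in> digits p N" "z \<in> digits p N" "i \<le> Suc N"
  shows "(\<forall>k<i. odo p N x y k = odo p N x z k) \<longleftrightarrow> (\<forall>k<i. y k = z k)"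
  using assms(3)
proof (induction i)
  case 0
  then show ?case by simp
next
  case (Suc i)
  then have IH: "(\<forall>k<i. odo p N x y k = odo p N x z k) \<longleftrightarrow> (\<forall>k<i. y k = z k)" and i: "i \<le> N"
    by auto
  have "odo p N x y i = odo p N x z i \<longleftrightarrow> y i = z i" if eq: "\<forall>k<i. y k = z k"
  proof -
    define c where "c = (if i = 0 then x N else of_bool (\<forall>k<i. x k = y k))"
    have "(\<forall>k<i. x k = y k) \<longleftrightarrow> (\<forall>k<i. x k = z k)" using eq by auto
    then have "odo p N x y i = (y i + c) mod int p" "odo p N x z i = (z i + c) mod int p"
      using i by (simp_all add: odo_def c_def)
    then show ?thesis
      using digits_add_cancel[OF _ assms(1,2) i] by metis
  qed
  then show ?case using IH by (auto simp: less_Suc_eq)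
qed

lemma odo_inj:
  assumes "y \<in> digits p N" "z \<in> digits p N" "odo p N x y = odo p N x z"
  shows "y = z"
proof (rule digits_ext[OF assms(1,2)])
  fix i assume "i \<le> N"
  then show "y i = z i"
    using odo_agree[OF assms(1,2), of "Suc N" x] assms(3) by auto
qed

lemma odo_bij:
  assumes "p > 0"
  shows "bij_betw (odo p N x) (digits p N) (digits p N)"
proof -
  have "inj_on (odo p N x) (digits p N)" by (auto intro: inj_onI odo_inj)
  then show ?thesis
    using odo_digits[OF assms] finite_digits
    by (simp add: bij_betw_def endo_inj_surj image_subset_iff)
qed

text \<open>Left multiplication preserves common prefixes, so at \<open>i > 0\<close> both sides add
  \<open>b x z + b y z\<close> to \<open>z i\<close>. At coordinate 0 both add
  \<open>x N + y N + c\<close>, where \<open>c\<close> is symmetric in \<open>x\<close> and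
  \<open>y\<close>; \<open>N > 0\<close> ensures that coordinate \<open>N\<close> follows the
  agreement rule.\<close>

lemma odo_cycle_set:
  assumes p: "p > 0" and N: "N > 0"
  shows "cycle_set (digits p N) (odo p N)"
  unfolding cycle_set_def
proof (intro conjI ballI)
  fix x y z assume X: "x \<in> digits p N" "y \<in> digits p N" "z \<in> digits p N"
  show "odo p N (odo p N x y) (odo p N x z) = odo p N (odo p N y x) (odo p N y z)"
  proof (rule digits_ext[OF odo_digits[OF p] odo_digits[OF p]])
    fix i assume i: "i \<le> N"
    show "odo p N (odo p N x y) (odo p N x z) i = odo p N (odo p N y x) (odo p N y z) i"
    proof (cases "i = 0")
      case True
      define c :: int where "c = of_bool (\<forall>k<N. x k = y k)"
      have "(\<forall>k<N. x k = y k) \<longleftrightarrow> (\<forall>k<N. y k = x k)" by auto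
      then have "odo p N x y N = (y N + c) mod int p" "odo p N y x N = (x N + c) mod int p"
        using N by (simp_all add: odo_def c_def)
      moreover have "odo p N u v 0 = (v 0 + u N) mod int p" for u v
        by (simp add: odo_def)
      ultimately show ?thesis
        using True by (simp add: mod_simps) (simp add: add_ac)
    next
      case False
      define b :: "(nat \<Rightarrow> int) \<Rightarrow> (nat \<Rightarrow> int) \<Rightarrow> int"
        where "b u v = of_bool (\<forall>k<i. u k = v k)" for u v
      have "b (odo p N x y) (odo p N x z) = b y z" "b (odo p N y x) (odo p N y z) = b x z"
        unfolding b_def using odo_agree X i by auto
      moreover have "odo p N u v i = (v i + b u v) mod int p" for u v
        using False i by (simp add: odo_def b_def)
      ultimately show ?thesis by (simp add: mod_simps) (simp add: add_ac)
    qed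
  qed
qed (simp add: odo_bij p)

text \<open>At \<open>i > 0\<close> the same amount is added to \<open>x i\<close> and
  \<open>u i\<close>, so the products determine \<open>x i - u i\<close> modulo \<open>p\<close>; at
  0 the difference is recovered with the help of the one at \<open>N\<close>. These differences tell
  where \<open>x\<close> and \<open>u\<close> agree, hence what was added, and it can be
  cancelled.\<close>

lemma odo_nondegenerate:
  assumes N: "N > 0"
    and X: "x \<in> digits p N" "u \<in> digits p N" "x' \<in> digits p N" "u' \<in> digits p N"
    and eq: "odo p N x u = odo p N x' u'" "odo p N u x = odo p N u' x'"
  shows "x = x'"
proof -
  have step: "odo p N a b i = (b i + of_bool (\<forall>k<i. a k = b k)) mod int p"
    if "i \<noteq> 0" "i \<le> N" for a b i
    using that by (simp add: odo_def)
  have sym: "(\<forall>k<i. a k = b k) \<longleftrightarrow> (\<forall>k<i. b k = a k)" for a b :: "nat \<Rightarrow> int" and i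
    by auto
  have diff: "[x i - u i = x' i - u' i] (mod int p)" if i: "i \<noteq> 0" "i \<le> N" for i
  proof -
    have "[(x i + of_bool (\<forall>k<i. x k = u k)) - (u i + of_bool (\<forall>k<i. x k = u k)) =
        (x' i + of_bool (\<forall>k<i. x' k = u' k)) - (u' i + of_bool (\<forall>k<i. x' k = u' k))] (mod int p)"
      using fun_cong[OF eq(1), of i] fun_cong[OF eq(2), of i]
      unfolding step[OF i] sym[of i u x] sym[of i u' x'] by (intro cong_diff) (simp_all add: cong_def)
    then show ?thesis by simp
  qed
  have diff0: "[x 0 - u 0 = x' 0 - u' 0] (mod int p)"
  proof -
    have "[(x 0 + u N) - (u 0 + x N) = (x' 0 + u' N) - (u' 0 + x' N)] (mod int p)"
      using fun_cong[OF eq(1), of 0] fun_cong[OF eq(2), of 0]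
      by (intro cong_diff) (simp_all add: cong_def odo_def)
    from cong_add[OF this diff[of N]] N show ?thesis by (simp add: algebra_simps)
  qed
  have "x i = u i \<longleftrightarrow> x' i = u' i" if i: "i \<le> N" for i
  proof -
    have "[x i - u i = x' i - u' i] (mod int p)" using diff diff0 i by (cases "i = 0") auto
    then have "[x i = u i] (mod int p) \<longleftrightarrow> [x' i = u' i] (mod int p)"
      by (metis cong_diff_iff_cong_0 cong_sym cong_trans)
    then show ?thesis using digits_mod X i by (simp add: cong_def)
  qed
  then have agree: "(\<forall>k<i. x k = u k) \<longleftrightarrow> (\<forall>k<i. x' k = u' k)" if "i \<le> N" for i
    using that by auto
  have pos: "x i = x' i" "u i = u' i" if i: "i \<noteq> 0" "i \<le> N" for i
  proof -
    have "(x i + of_bool (\<forall>k<i. x k = u k)) mod int p = (x' i + of_bool (\<forall>k<i. x k = u k)) mod int p"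
      "(u i + of_bool (\<forall>k<i. x k = u k)) mod int p = (u' i + of_bool (\<forall>k<i. x k = u k)) mod int p"
      using fun_cong[OF eq(1), of i] fun_cong[OF eq(2), of i] agree[OF i(2)]
      unfolding step[OF i] sym[of i u x] sym[of i u' x'] by simp_all
    then show "x i = x' i" "u i = u' i" using digits_add_cancel X i by blast+
  qed
  have "(x 0 + u N) mod int p = (x' 0 + u N) mod int p"
    using fun_cong[OF eq(2), of 0] pos(2)[of N] N by (simp add: odo_def)
  then have "x 0 = x' 0" using digits_add_cancel X by blast
  then show ?thesis using digits_ext[OF X(1,3)] pos(1) by metis
qed

section \<open>Congruences of the twisted odometer\<close>

locale odo_congruence =
  fixes p N :: nat and f :: "(nat \<Rightarrow> int) \<Rightarrow> 'b"
  assumes prime: "prime p" and N: "N > 0"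
    and cong: "\<lbrakk>x \<in> digits p N; x' \<in> digits p N; y \<in> digits p N; y' \<in> digits p N;
       f x = f x'; f y = f y'\<rbrakk> \<Longrightarrow> f (odo p N x y) = f (odo p N x' y')"
begin

lemma p_gt_1: "int p > 1"
  using prime_gt_1_nat[OF prime] by simp

lemma odo_closed [simp]: "odo p N x y \<in> digits p N"
  using p_gt_1 by (intro odo_digits) simp

definition split_at :: "nat \<Rightarrow> (nat \<Rightarrow> int) \<Rightarrow> (nat \<Rightarrow> int) \<Rightarrow> bool" where
  "split_at j a b \<longleftrightarrow> a \<in> digits p N \<and> b \<in> digits p N \<and> f a = f b \<and>
     (\<forall>k<j. a k = b k) \<and> a j \<noteq> b j"

text \<open>Replacing \<open>(a, b)\<close> by \<open>(odo p N a a, odo p N a b)\<close> raises the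
  last coordinate of \<open>a\<close> by 1 but leaves that of \<open>b\<close> alone, because
  \<open>a\<close> and \<open>b\<close> already differ at \<open>j < N\<close>. Repeating this
  closes the gap \<open>d\<close> between the two.\<close>

lemma split_at_equal_last:
  assumes "split_at j a b" "j < N"
  shows "\<exists>a b. split_at j a b \<and> a N = b N"
proof -
  have "\<exists>a b. split_at j a b \<and> a N = b N"
    if "split_at j a b" "(a N + int d) mod int p = b N" for d a b
    using that
  proof (induction d arbitrary: a b)
    case 0
    then have "a N = b N" using digits_mod[of a p N N] by (simp add: split_at_def)
    then show ?case using 0(1) by blast
  next
    case (Suc d)
    then have ab: "a \<in> digits p N" "b \<in> digits p N" "f a = f b" "\<forall>k<j. a k = b k" "a j \<noteq> b j"
      unfolding split_at_def by blast+
    have "\<forall>k<j. odo p N a a k = odo p N a b k" "\<not> (\<forall>k<Suc j. odo p N a a k = odo p N a b k)"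
      using odo_agree[OF ab(1,2)] ab(4,5) assms(2) by auto
    then have "odo p N a a j \<noteq> odo p N a b j" by (metis less_Suc_eq)
    then have "split_at j (odo p N a a) (odo p N a b)"
      unfolding split_at_def
      using cong[OF ab(1,1,1,2) refl ab(3)] \<open>\<forall>k<j. odo p N a a k = odo p N a b k\<close> by simp
    moreover have "odo p N a a N = (a N + 1) mod int p"
      using N by (simp add: odo_def)
    moreover have "odo p N a b N = b N"
      using odo_unchanged[OF ab(2) assms(2), of a] ab(5) by simp
    ultimately show ?case
      using Suc.prems(2) by (intro Suc.IH[of "odo p N a a" "odo p N a b"])
        (simp_all add: mod_simps algebra_simps)
  qed
  moreover have "(a N + int (nat ((b N - a N) mod int p))) mod int p = b N"
    using assms(1) digits_mod[of b p N N] p_gt_1 by (simp add: split_at_def mod_simps)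
  ultimately show ?thesis using assms(1) by blast
qed

text \<open>Let \<open>a\<close> and \<open>b\<close> both act on \<open>a\<close>. Equal last
  coordinates give the same result at 0, the common prefix gives it up to \<open>j\<close>, but at
  \<open>Suc j\<close> only the action of \<open>a\<close> adds 1.\<close>

lemma split_at_Suc:
  assumes "split_at j a b" "j < N"
  shows "\<exists>a b. split_at (Suc j) a b"
proof -
  obtain a b where ab: "a \<in> digits p N" "b \<in> digits p N" "f a = f b" "\<forall>k<j. a k = b k" "a j \<noteq> b j"
    and last: "a N = b N"
    using split_at_equal_last[OF assms] unfolding split_at_def by blast
  have "odo p N a a k = odo p N b a k" if "k \<le> j" for k
  proof -
    have "\<forall>l<k. b l = a l" using that ab(4) by auto
    then show ?thesis using last by (simp add: odo_def)
  qed
  moreover have "odo p N a a (Suc j) \<noteq> odo p N b a (Suc j)"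
  proof
    have "odo p N b a (Suc j) = a (Suc j)" "odo p N a a (Suc j) = (1 + a (Suc j)) mod int p"
      using odo_unchanged[OF ab(1), of j "Suc j" b] ab(5) assms(2) by (simp_all add: odo_def add.commute)
    moreover assume "odo p N a a (Suc j) = odo p N b a (Suc j)"
    ultimately have "(1 + a (Suc j)) mod int p = (0 + a (Suc j)) mod int p"
      using digits_mod[OF ab(1), of "Suc j"] assms(2) by simp
    then have "1 = (0 :: int)"
      by (rule mod_add_cancel_bounded) (use p_gt_1 in auto)
    then show False by simp
  qed
  moreover have "f (odo p N a a) = f (odo p N b a)" using cong[OF ab(1,2,1,1,3) refl] .
  ultimately have "split_at (Suc j) (odo p N a a) (odo p N b a)"
    by (simp add: split_at_def less_Suc_eq_le)
  then show ?thesis by blast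
qed

lemma split_at_last:
  assumes "\<not> inj_on f (digits p N)"
  shows "\<exists>a b. split_at N a b"
proof -
  obtain a b where ab: "a \<in> digits p N" "b \<in> digits p N" "f a = f b" "a \<noteq> b"
    using assms by (auto simp: inj_on_def)
  define j where "j = (LEAST j. a j \<noteq> b j)"
  obtain i where i: "i \<le> N" "a i \<noteq> b i" using digits_ext ab by blast
  have "j \<le> N" using Least_le[of "\<lambda>j. a j \<noteq> b j", OF i(2)] i(1) by (simp add: j_def)
  have "a j \<noteq> b j" unfolding j_def by (rule LeastI[of "\<lambda>j. a j \<noteq> b j", OF i(2)])
  moreover have "\<forall>k<j. a k = b k" unfolding j_def by (blast dest: not_less_Least)
  ultimately have "split_at j a b" using ab by (simp add: split_at_def)
  with \<open>j \<le> N\<close> show ?thesis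
  proof (induction "N - j" arbitrary: j a b)
    case 0
    then show ?case by auto
  next
    case (Suc d)
    then have "j < N" by simp
    with split_at_Suc[OF Suc.prems(2)] obtain a b where "split_at (Suc j) a b" by blast
    with Suc.hyps(1)[of "Suc j"] Suc.hyps(2) \<open>j < N\<close> show ?case by simp
  qed
qed

text \<open>The multiples of \<open>d\<close> cover all residues modulo \<open>p\<close>, so
  iterating the shift reaches every value \<open>v\<close>.\<close>

lemma coordinate_irrelevant:
  assumes shift: "\<And>w. w \<in> digits p N \<Longrightarrow> f (w(i := (w i + d) mod int p)) = f w"
    and i: "i \<le> N" and d: "coprime d (int p)"
    and w: "w \<in> digits p N" and v: "0 \<le> v" "v < int p"
  shows "f (w(i := v)) = f w"
proof -
  have iter: "f (w(i := (w i + int k * d) mod int p)) = f w" for k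
  proof (induction k)
    case 0
    then show ?case using digits_mod[OF w i] by simp
  next
    case (Suc k)
    let ?u = "w(i := (w i + int k * d) mod int p)"
    have "((w i + int k * d) mod int p + d) mod int p = (w i + int (Suc k) * d) mod int p"
      by (simp add: mod_simps) (simp add: algebra_simps)
    then have "f (w(i := (w i + int (Suc k) * d) mod int p)) = f (?u(i := (?u i + d) mod int p))"
      by (simp only: fun_upd_same fun_upd_upd)
    also have "\<dots> = f ?u"
      by (rule shift, rule digits_upd[OF w i]) (use p_gt_1 in auto)
    finally show ?case using Suc by (simp only:)
  qed
  obtain e where e: "[d * e = 1] (mod int p)" using cong_solve_coprime_int[OF d] by blast
  \<comment> \<open>With \<open>e\<close> inverse to \<open>d\<close> modulo \<open>p\<close>, this
    \<open>k\<close> solves \<open>w i + k * d = v\<close> modulo \<open>p\<close>.\<close>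
  define k where "k = nat (e * (v - w i) mod int p)"
  have "[int k * d = v - w i] (mod int p)"
  proof -
    have "[int k * d = (d * e) * (v - w i)] (mod int p)"
      using p_gt_1 by (simp add: k_def cong_def mod_simps algebra_simps)
    also have "[(d * e) * (v - w i) = 1 * (v - w i)] (mod int p)"
      by (intro cong_mult e cong_refl)
    finally show ?thesis by simp
  qed
  then have "[w i + int k * d = w i + (v - w i)] (mod int p)" by (intro cong_add cong_refl)
  then have "(w i + int k * d) mod int p = v" using v by (simp add: cong_def)
  then show ?thesis using iter[of k] by simp
qed

text \<open>Write \<open>w\<close> as \<open>odo p N a z\<close>. Increments depend only on
  coordinates below \<open>N\<close>, where \<open>a\<close> and \<open>b\<close> agree, so
  \<open>odo p N b z\<close> differs from \<open>w\<close> just by the shift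
  \<open>b N - a N\<close> at 0. This shift is nonzero modulo the prime \<open>p\<close>, hence
  coprime to it.\<close>

lemma first_coordinate_irrelevant:
  assumes ab: "split_at N a b" and w: "w \<in> digits p N" and v: "0 \<le> v" "v < int p"
  shows "f (w(0 := v)) = f w"
proof (rule coordinate_irrelevant[where d = "b N - a N"])
  have X: "a \<in> digits p N" "b \<in> digits p N" "f a = f b" "\<forall>k<N. a k = b k" "a N \<noteq> b N"
    using ab by (auto simp: split_at_def)
  show "f (w(0 := (w 0 + (b N - a N)) mod int p)) = f w" if w: "w \<in> digits p N" for w
  proof -
    obtain z where z: "z \<in> digits p N" "w = odo p N a z"
      using odo_bij[of p N a] p_gt_1 w unfolding bij_betw_def by force
    have "w(0 := (w 0 + (b N - a N)) mod int p) = odo p N b z"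
    proof
      fix i
      have "(\<forall>k<i. a k = z k) \<longleftrightarrow> (\<forall>k<i. b k = z k)" if "i \<le> N"
        using X(4) that by auto
      then show "(w(0 := (w 0 + (b N - a N)) mod int p)) i = odo p N b z i"
        by (auto simp: z(2) odo_def mod_simps)
    qed
    moreover have "f (odo p N a z) = f (odo p N b z)" using cong[OF X(1,2) z(1,1) X(3) refl] .
    ultimately show ?thesis using z by simp
  qed
  have "\<not> int p dvd b N - a N"
  proof
    assume "int p dvd b N - a N"
    then have "b N mod int p = a N mod int p" by (simp add: mod_eq_dvd_iff)
    then show False using X digits_mod by simp
  qed
  moreover have "prime (int p)" using prime by simp
  ultimately show "coprime (b N - a N) (int p)"
    using prime_imp_coprime coprime_commute by blast
qed (use w v in auto)

text \<open>Induction on \<open>j\<close>, with \<open>first\<close> as base case. In the step it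
  suffices to raise coordinate \<open>Suc j\<close> by 1 up to changes at coordinates
  \<open>0, ..., j\<close>, which the induction hypothesis absorbs.\<close>

lemma lower_coordinates_irrelevant:
  assumes first: "\<And>w v. \<lbrakk>w \<in> digits p N; 0 \<le> v; v < int p\<rbrakk> \<Longrightarrow> f (w(0 := v)) = f w"
    and "j \<le> N" "w \<in> digits p N" "w' \<in> digits p N" "\<And>k. j < k \<Longrightarrow> k \<le> N \<Longrightarrow> w k = w' k"
  shows "f w = f w'"
  using assms(2-)
proof (induction j arbitrary: w w')
  case 0
  have "w' = w(0 := w' 0)"
    using 0 digits_upd[OF 0(2), of 0 "w' 0"] digits_bounds[OF 0(3), of 0]
    by (intro digits_ext[OF 0(3)]) auto
  then show ?case using first[OF 0(2)] digits_bounds[OF 0(3), of 0] by (metis zero_le)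
next
  case (Suc j)
  have shift: "f (w(Suc j := (w (Suc j) + 1) mod int p)) = f w" if w: "w \<in> digits p N" for w
  proof -
    \<comment> \<open>\<open>x\<close> raises exactly the coordinates \<open>1, \<dots>, Suc j\<close> of \<open>w\<close>, and \<open>x'\<close> fixes \<open>w\<close>.\<close>
    define x where "x = (\<lambda>k\<in>{..N}. if k \<le> j then w k else if k = N then 0 else (w k + 1) mod int p)"
    define x' where "x' = x(0 := (x 0 + 1) mod int p)"
    have x: "x \<in> digits p N"
      using digits_bounds[OF w] p_gt_1 by (auto simp: digits_def x_def)
    have x': "x' \<in> digits p N"
      unfolding x'_def using digits_upd[OF x] p_gt_1 by simp
    have next_neq: "(w k + 1) mod int p \<noteq> w k" if "k \<le> N" for k
    proof
      assume "(w k + 1) mod int p = w k"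
      then have "(1 + w k) mod int p = (0 + w k) mod int p"
        using digits_mod[OF w that] by (simp add: add.commute)
      then have "1 = (0 :: int)"
        by (rule mod_add_cancel_bounded) (use p_gt_1 in auto)
      then show False by simp
    qed
    \<comment> \<open>Since \<open>j < N\<close>, the value at \<open>N\<close> is 0, so acting by
      \<open>x\<close> or \<open>x'\<close> leaves coordinate 0 of \<open>w\<close> alone.\<close>
    have xN: "x N = 0" using Suc.prems(1) by (simp add: x_def)
    have "odo p N x' w = w"
    proof (rule digits_ext[OF odo_closed w])
      fix i assume i: "i \<le> N"
      have "x' 0 \<noteq> w 0" using next_neq[of 0] by (simp add: x'_def x_def)
      then show "odo p N x' w i = w i"
        using i N xN digits_mod[OF w i] by (auto simp: odo_def x'_def)
    qed
    moreover have "f (odo p N x w) = f (odo p N x' w)"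
      by (rule cong[OF x x' w w _ refl]) (use first[OF x] p_gt_1 in \<open>simp add: x'_def\<close>)
    \<comment> \<open>\<open>odo p N x w\<close> also raises the coordinates from 1 to
      \<open>j\<close>, but the induction hypothesis compares only those above
      \<open>j\<close>.\<close>
    moreover have "f (w(Suc j := (w (Suc j) + 1) mod int p)) = f (odo p N x w)"
    proof (rule Suc.IH)
      show "w(Suc j := (w (Suc j) + 1) mod int p) \<in> digits p N"
        using digits_upd[OF w] Suc.prems(1) p_gt_1 by simp
      fix k assume k: "j < k" "k \<le> N"
      show "(w(Suc j := (w (Suc j) + 1) mod int p)) k = odo p N x w k"
      proof (cases "k = Suc j")
        case True
        then have "\<forall>l<k. x l = w l" using k by (auto simp: x_def)
        then show ?thesis using True k by (simp add: odo_def)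
      next
        case False
        then have "Suc j < k" using k by simp
        \<comment> \<open>Now \<open>Suc j < N\<close>, so \<open>x (Suc j)\<close> is the raised
          coordinate of \<open>w\<close> and not the special value 0.\<close>
        moreover have "x (Suc j) \<noteq> w (Suc j)"
          using \<open>Suc j < k\<close> k next_neq[of "Suc j"] by (simp add: x_def)
        ultimately show ?thesis using False odo_unchanged[OF w _ k(2)] by simp
      qed
    qed (use Suc.prems(1) in auto)
    ultimately show ?thesis by simp
  qed
  have bounds: "0 \<le> w' (Suc j)" "w' (Suc j) < int p"
    using digits_bounds Suc.prems by auto
  have "f w = f (w(Suc j := w' (Suc j)))"
    using coordinate_irrelevant[OF shift Suc.prems(1) _ Suc.prems(2) bounds] by simp
  also have "\<dots> = f w'"
  proof (rule Suc.IH)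
    show "w(Suc j := w' (Suc j)) \<in> digits p N"
      by (rule digits_upd[OF Suc.prems(2,1) bounds])
    show "(w(Suc j := w' (Suc j))) k = w' k" if "j < k" "k \<le> N" for k
      using Suc.prems(4) that by (cases "k = Suc j") auto
  qed (use Suc.prems in auto)
  finally show ?case .
qed

lemma constant_unless_inj:
  assumes "\<not> inj_on f (digits p N)"
  shows "\<exists>c. \<forall>x \<in> digits p N. f x = c"
proof -
  obtain a b where "split_at N a b" using split_at_last[OF assms] by blast
  then have "f w = f w'" if "w \<in> digits p N" "w' \<in> digits p N" for w w'
    \<comment> \<open>For \<open>j = N\<close> no coordinate remains on which \<open>w\<close> and
      \<open>w'\<close> must agree.\<close>
    using lower_coordinates_irrelevant[where j = N and w = w and w' = w']
      first_coordinate_irrelevant that by simp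
  then show ?thesis by blast
qed

end

theorem mainTheorem1:
  fixes p n :: nat
  assumes "prime p" and "n > 1"
  shows "\<exists>(X :: nat set) r. ybe_simple X r \<and> card X = p ^ n"
proof -
  define N where "N = n - 1"
  have N: "N > 0" "n = Suc N" using assms(2) by (auto simp: N_def)
  have p: "p > 1" by (rule prime_gt_1_nat[OF assms(1)])
  let ?X = "digits p N" and ?r = "cycle_map (digits p N) (odo p N)"
  have cs: "cycle_set ?X (odo p N)" using odo_cycle_set N p by simp
  have card: "card ?X > 1" using one_less_power[OF p, of n] N card_digits by simp
  then have "?X \<noteq> {}" by auto
  then have sol: "ybe_solution ?X ?r"
    using ybe_solution_cycle_map[OF cs finite_digits] odo_nondegenerate[OF N(1)] by blast
  have "ybe_simple ?X ?r"
  proof (rule ybe_simple_cycle_map[OF cs sol card])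
    fix f :: "(nat \<Rightarrow> int) \<Rightarrow> nat \<Rightarrow> int"
    assume "\<And>x x' y y'. \<lbrakk>x \<in> ?X; x' \<in> ?X; y \<in> ?X; y' \<in> ?X; f x = f x'; f y = f y'\<rbrakk>
      \<Longrightarrow> f (odo p N x y) = f (odo p N x' y')"
    then have "odo_congruence p N f" using assms(1) N(1) by unfold_locales blast+
    then show "\<not> inj_on f ?X \<Longrightarrow> \<exists>c. \<forall>x \<in> ?X. f x = c"
      by (rule odo_congruence.constant_unless_inj)
  qed
  moreover obtain g where "bij_betw g ?X {0..<card ?X}"
    using ex_bij_betw_finite_nat[OF finite_digits] by blast
  ultimately obtain t where "ybe_simple {0..<card ?X} t"
    using ybe_simple_transport by blast
  then show ?thesis
    using card_digits[of p N] N by (metis card_atLeastLessThan diff_zero)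
qed

end
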